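(* (1) There is a one-to-one map from the set of isomorphism classes of countable graphs into the set of isomorphism classes of countable symmetrically indivisible graphs. (2) There is a one-to-one map from the set of isomorphism classes of countable linear orders into the set of isomorphism classes of countable symmetrically indivisible linear orders.
   Context: Graphs are structures in the language with one binary relation symbol $E$ (irreflexive and symmetric), and linear orders are structures in the language $\{<\}$; substructures are induced. A substructure $\mathcal{N}\subseteq\mathcal{M}$ is symmetrically embedded in $\mathcal{M}$ if every automorphism of $\mathcal{N}$ extends to an automorphism of $\mathcal{M}$. A structure $\mathcal{M}$ is symmetrically indivisible if for every colouring of its universe in two colours there is a monochromatic substructure $\mathcal{M}'\subseteq\mathcal{M}$ such that $\mathcal{M}'\cong\mathcal{M}$ and $\mathcal{M}'$ is symmetrically embedded in $\mathcal{M}$. *)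

theory Defs
  imports "HOL-Library.Countable_Set"
begin

text \<open>
  Structures in a language with one binary relation symbol: this covers both the
  language \<open>{E}\<close> of graphs and the language \<open>{<}\<close> of linear orders.  Universes are
  nonempty, and the interpretation of the symbol is a set of pairs over the universe.
\<close>

record 'a rel_struct =
  universe :: "'a set"
  rel :: "('a \<times> 'a) set"

definition is_struct :: "'a rel_struct \<Rightarrow> bool" where
  "is_struct M \<longleftrightarrow> universe M \<noteq> {} \<and> rel M \<subseteq> universe M \<times> universe M"

definition is_graph :: "'a rel_struct \<Rightarrow> bool" where
  "is_graph M \<longleftrightarrow> is_struct M \<and> irrefl (rel M) \<and> sym (rel M)"

definition is_linorder :: "'a rel_struct \<Rightarrow> bool" where
  "is_linorder M \<longleftrightarrow> is_struct M \<and> strict_linear_order_on (universe M) (rel M)"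

text \<open>
  Only the values of \<open>h\<close> on \<open>universe M\<close> matter, in this and the following definitions.
\<close>

definition is_iso :: "('a \<Rightarrow> 'b) \<Rightarrow> 'a rel_struct \<Rightarrow> 'b rel_struct \<Rightarrow> bool" where
  "is_iso h M N \<longleftrightarrow> bij_betw h (universe M) (universe N) \<and>
     (\<forall>x\<in>universe M. \<forall>y\<in>universe M. (x, y) \<in> rel M \<longleftrightarrow> (h x, h y) \<in> rel N)"

definition isomorphic :: "'a rel_struct \<Rightarrow> 'b rel_struct \<Rightarrow> bool" where
  "isomorphic M N \<longleftrightarrow> (\<exists>h. is_iso h M N)"

abbreviation is_automorphism :: "('a \<Rightarrow> 'a) \<Rightarrow> 'a rel_struct \<Rightarrow> bool" where
  "is_automorphism h M \<equiv> is_iso h M M"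

definition substructure :: "'a rel_struct \<Rightarrow> 'a rel_struct \<Rightarrow> bool" where
  "substructure N M \<longleftrightarrow> is_struct N \<and> universe N \<subseteq> universe M \<and>
     rel N = rel M \<inter> (universe N \<times> universe N)"

definition symmetrically_embedded :: "'a rel_struct \<Rightarrow> 'a rel_struct \<Rightarrow> bool" where
  "symmetrically_embedded N M \<longleftrightarrow> substructure N M \<and>
     (\<forall>f. is_automorphism f N \<longrightarrow>
        (\<exists>g. is_automorphism g M \<and> (\<forall>x\<in>universe N. g x = f x)))"

definition symmetrically_indivisible :: "'a rel_struct \<Rightarrow> bool" where
  "symmetrically_indivisible M \<longleftrightarrow>
     (\<forall>c :: 'a \<Rightarrow> bool. \<exists>M'. substructure M' M \<and>
        (\<exists>b. \<forall>x\<in>universe M'. c x = b) \<and>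
        isomorphic M' M \<and> symmetrically_embedded M' M)"

definition iso_classes :: "'a rel_struct set \<Rightarrow> 'a rel_struct set set" where
  "iso_classes K = K // {(M, N). M \<in> K \<and> N \<in> K \<and> isomorphic M N}"

text \<open>
  ``Countable'' means finite or countably infinite.  The classes of structures below are
  used at type \<^typ>\<open>nat\<close>, i.e. with universes that are sets of natural numbers; by the
  lemma \<open>countable_struct_has_nat_copy\<close> this represents every isomorphism type of
  countable structures.
\<close>

definition countable_graphs :: "'a rel_struct set" where
  "countable_graphs = {M. is_graph M \<and> countable (universe M)}"

definition countable_linorders :: "'a rel_struct set" where
  "countable_linorders = {M. is_linorder M \<and> countable (universe M)}"

lemma isomorphic_refl: "isomorphic M M"
  unfolding isomorphic_def is_iso_def by (intro exI[of _ id]) simp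

lemma isomorphic_sym:
  assumes "isomorphic M N" shows "isomorphic N M"
proof -
  obtain h where h: "is_iso h M N"
    using assms unfolding isomorphic_def by blast
  let ?k = "the_inv_into (universe M) h"
  have b: "bij_betw h (universe M) (universe N)"
    using h unfolding is_iso_def by blast
  have k: "?k y \<in> universe M" "h (?k y) = y" if "y \<in> universe N" for y
    using b that
    by (auto simp: bij_betw_def f_the_inv_into_f intro!: the_inv_into_into)
  have "is_iso ?k N M"
    unfolding is_iso_def
  proof (intro conjI ballI)
    show "bij_betw ?k (universe N) (universe M)"
      by (rule bij_betw_the_inv_into[OF b])
  next
    fix x y assume "x \<in> universe N" "y \<in> universe N"
    then show "(x, y) \<in> rel N \<longleftrightarrow> (?k x, ?k y) \<in> rel M"
      using k[of x] k[of y] h unfolding is_iso_def by metis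
  qed
  then show ?thesis unfolding isomorphic_def by blast
qed

lemma isomorphic_trans:
  assumes "isomorphic M N" "isomorphic N P" shows "isomorphic M P"
proof -
  obtain h k where h: "is_iso h M N" and k: "is_iso k N P"
    using assms unfolding isomorphic_def by blast
  have m: "h x \<in> universe N" if "x \<in> universe M" for x
    using h that unfolding is_iso_def bij_betw_def by blast
  have "is_iso (k \<circ> h) M P"
    using h k m unfolding is_iso_def by (auto intro: bij_betw_trans)
  then show ?thesis unfolding isomorphic_def by blast
qed

lemma equiv_isomorphic: "equiv K {(M, N). M \<in> K \<and> N \<in> K \<and> isomorphic M N}"
proof (rule equivI)
  show "refl_on K {(M, N). M \<in> K \<and> N \<in> K \<and> isomorphic M N}"
    by (simp add: refl_on_def isomorphic_refl)
  show "sym {(M, N). M \<in> K \<and> N \<in> K \<and> isomorphic M N}"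
    by (rule symI) (use isomorphic_sym in blast)
  show "trans {(M, N). M \<in> K \<and> N \<in> K \<and> isomorphic M N}"
    by (rule transI) (use isomorphic_trans in blast)
qed blast

lemma countable_struct_has_nat_copy:
  fixes M :: "'a rel_struct"
  assumes "is_struct M" "countable (universe M)"
  shows "\<exists>N :: nat rel_struct. is_struct N \<and> isomorphic M N \<and>
    (is_graph M \<longrightarrow> is_graph N) \<and> (is_linorder M \<longrightarrow> is_linorder N)"
proof -
  obtain h :: "'a \<Rightarrow> nat" where h: "inj_on h (universe M)"
    using assms(2) unfolding countable_def by blast
  have sub: "x \<in> universe M \<and> y \<in> universe M" if "(x, y) \<in> rel M" for x y
    using assms(1) that unfolding is_struct_def by blast
  define N where "N = \<lparr>universe = h ` universe M, rel = map_prod h h ` rel M\<rparr>"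
  have r: "(h x, h y) \<in> rel N \<longleftrightarrow> (x, y) \<in> rel M"
    if "x \<in> universe M" "y \<in> universe M" for x y
  proof
    assume "(h x, h y) \<in> rel N"
    then obtain x' y' where "h x = h x'" "h y = h y'" "(x', y') \<in> rel M"
      unfolding N_def by auto
    then show "(x, y) \<in> rel M"
      using that sub h by (metis inj_onD)
  next
    assume "(x, y) \<in> rel M"
    then show "(h x, h y) \<in> rel N"
      unfolding N_def by (auto simp: map_prod_def intro: rev_image_eqI)
  qed
  have rE: "\<exists>x y. u = h x \<and> v = h y \<and> (x, y) \<in> rel M" if "(u, v) \<in> rel N" for u v
    using that unfolding N_def by auto
  have u: "universe N = h ` universe M"
    unfolding N_def by simp
  have s: "is_struct N"
    using assms(1) sub unfolding is_struct_def N_def by auto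
  have i: "isomorphic M N"
    using h r u unfolding isomorphic_def is_iso_def bij_betw_def by blast
  have g: "is_graph N" if "is_graph M"
    using that s rE r sub unfolding is_graph_def irrefl_def sym_def by (metis)
  have l: "is_linorder N" if M: "is_linorder M"
  proof -
    have M': "trans (rel M)" "irrefl (rel M)" "total_on (universe M) (rel M)"
      using M unfolding is_linorder_def strict_linear_order_on_def by auto
    have "trans (rel N)"
    proof (rule transI)
      fix a b c assume "(a, b) \<in> rel N" "(b, c) \<in> rel N"
      then obtain x y y' z where "a = h x" "b = h y" "(x, y) \<in> rel M"
        "b = h y'" "c = h z" "(y', z) \<in> rel M"
        using rE by metis
      then show "(a, c) \<in> rel N"
        using M'(1) sub r h by (metis inj_onD transD)
    qed
    moreover have "irrefl (rel N)"
      using M'(2) rE r sub unfolding irrefl_def by metis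
    moreover have "total_on (universe N) (rel N)"
      using M'(3) r unfolding total_on_def u by (metis imageE)
    ultimately show ?thesis
      using s unfolding is_linorder_def strict_linear_order_on_def by blast
  qed
  show ?thesis using s i g l by blast
qed

end

theory Submission
  imports Defs
begin

text \<open>
  Both target sets have the cardinality of the continuum, so it suffices to encode each set
  \<open>X\<close> of natural numbers in a countable symmetrically indivisible structure, in such a way that
  distinct sets give non-isomorphic structures; the isomorphism class of \<open>M\<close> is then
  sent to the structure coding a representative of it.  Let \<open>s\<close> be the function
  \<open>block_size X\<close> below, which is injective and determines \<open>X\<close> through its values.

  The graph is the disjoint union of the complete graphs on \<open>s k\<close> vertices.  One of the two
  colours has unboundedly many vertices in the components, so all the components can be
  embedded into distinct monochromatic parts of components.  Automorphisms of the copy permute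
  each block separately, and hence extend by the identity.

  The linear order is obtained from the rationals by replacing the \<open>k\<close>-th of
  them by a chain of length \<open>s k\<close>.  The maximal finite convex blocks
  have pairwise distinct lengths, so this order is rigid.  One of the two colours
  contains a copy of the rationals and hence a copy of every countable order; by rigidity any
  copy is symmetrically embedded.
\<close>

section \<open>Isomorphisms and symmetric indivisibility\<close>

lemma is_iso_comp:
  assumes "is_iso h M N" "is_iso k N P"
  shows "is_iso (k \<circ> h) M P"
  using assms bij_betw_apply[of h "universe M" "universe N"]
  unfolding is_iso_def by (auto intro: bij_betw_trans)

lemma is_iso_mem:
  assumes "is_iso h M N" "x \<in> universe M"
  shows "h x \<in> universe N"
  using assms bij_betw_apply unfolding is_iso_def by fast

lemma is_iso_inverse:
  assumes "is_iso h M N"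
  obtains k where "is_iso k N M" "\<And>x. x \<in> universe M \<Longrightarrow> k (h x) = x"
    "\<And>y. y \<in> universe N \<Longrightarrow> h (k y) = y"
proof -
  let ?k = "inv_into (universe M) h"
  have b: "bij_betw h (universe M) (universe N)"
    using assms unfolding is_iso_def by blast
  have 1: "?k (h x) = x" if "x \<in> universe M" for x
    using b that by (simp add: bij_betw_inv_into_left)
  have 2: "h (?k y) = y" if "y \<in> universe N" for y
    using b that by (simp add: bij_betw_inv_into_right)
  have b': "bij_betw ?k (universe N) (universe M)"
    using b by (rule bij_betw_inv_into)
  have "is_iso ?k N M"
    unfolding is_iso_def using assms 2 b' bij_betw_apply[OF b']
    by (auto simp: is_iso_def)
  with 1 2 show ?thesis using that by blast
qed

text \<open>The codings below live on pairs, while the isomorphism classes are those of structures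
  on the naturals; this moves the property to a copy. A colouring is pulled back along
  \<open>h\<close>, the monochromatic copy is pushed forward, and automorphisms are conjugated by
  \<open>h\<close>.\<close>

lemma symmetrically_indivisible_isomorphic:
  fixes M :: "'a rel_struct" and N :: "'b rel_struct"
  assumes MN: "isomorphic M N" and M: "symmetrically_indivisible M" and N: "is_struct N"
  shows "symmetrically_indivisible N"
  unfolding symmetrically_indivisible_def
proof
  fix c :: "'b \<Rightarrow> bool"
  obtain h where h: "is_iso h M N"
    using MN unfolding isomorphic_def by blast
  obtain k where k: "is_iso k N M" and kh: "\<And>x. x \<in> universe M \<Longrightarrow> k (h x) = x"
    and hk: "\<And>y. y \<in> universe N \<Longrightarrow> h (k y) = y"
    using is_iso_inverse[OF h] by blast
  obtain M' b where M': "substructure M' M" and b: "\<forall>x\<in>universe M'. (c \<circ> h) x = b"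
    and iso: "isomorphic M' M" and emb: "symmetrically_embedded M' M"
    using M unfolding symmetrically_indivisible_def by metis
  have sub: "universe M' \<subseteq> universe M" and rel: "rel M' = rel M \<inter> universe M' \<times> universe M'"
    and ne: "universe M' \<noteq> {}"
    using M' unfolding substructure_def is_struct_def by auto
  define N' where "N' = \<lparr>universe = h ` universe M',
    rel = rel N \<inter> (h ` universe M') \<times> (h ` universe M')\<rparr>"
  have hN: "h ` universe M' \<subseteq> universe N"
    using sub is_iso_mem[OF h] by blast
  have N': "substructure N' N"
    using hN ne unfolding substructure_def is_struct_def N'_def by auto
  have h': "is_iso h M' N'"
    using h sub rel unfolding is_iso_def N'_def
    by (auto intro: bij_betw_subset simp: subset_iff)
  have k': "is_iso k N' M'"
  proof -
    have "bij_betw k (universe N') (universe M')"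
      by (rule bij_betw_byWitness[where f' = h])
        (use sub kh in \<open>auto simp: N'_def subset_iff\<close>)
    then show ?thesis
      using k hN rel sub kh unfolding is_iso_def N'_def by (auto simp: subset_iff)
  qed
  have "isomorphic N' N"
    using h' iso MN isomorphic_sym isomorphic_trans unfolding isomorphic_def[of M' N']
    by (metis isomorphic_def)
  moreover have "symmetrically_embedded N' N"
    unfolding symmetrically_embedded_def
  proof (intro conjI allI impI N')
    fix f assume f: "is_automorphism f N'"
    have "is_automorphism (k \<circ> f \<circ> h) M'"
      using is_iso_comp[OF h' is_iso_comp[OF f k']] by (simp add: comp_assoc)
    then obtain g where g: "is_automorphism g M"
      and gf: "\<forall>x\<in>universe M'. g x = (k \<circ> f \<circ> h) x"
      using emb unfolding symmetrically_embedded_def by blast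
    have "is_automorphism (h \<circ> g \<circ> k) N"
      using is_iso_comp[OF k is_iso_comp[OF g h]] by (simp add: comp_assoc)
    moreover have "(h \<circ> g \<circ> k) y = f y" if y: "y \<in> universe N'" for y
    proof -
      have "f y \<in> universe N" "y \<in> universe N"
        using is_iso_mem[OF f y] y hN unfolding N'_def by auto
      then show ?thesis
        using gf is_iso_mem[OF k' y] hk by simp
    qed
    ultimately show "\<exists>g. is_automorphism g N \<and> (\<forall>x\<in>universe N'. g x = f x)"
      by blast
  qed
  moreover have "\<forall>y\<in>universe N'. c y = b"
    using b unfolding N'_def by simp
  ultimately show "\<exists>N'. substructure N' N \<and> (\<exists>b. \<forall>x\<in>universe N'. c x = b) \<and>
      isomorphic N' N \<and> symmetrically_embedded N' N"
    using N' by blast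
qed

text \<open>Replaces substructures by self-embeddings \<open>h\<close>. Every automorphism of the
  image of \<open>h\<close> is a conjugate by \<open>h\<close> of an automorphism \<open>f\<close>
  of \<open>M\<close>, so extending it to \<open>g\<close> amounts to \<open>g\<close> after
  \<open>h\<close> being \<open>h\<close> after \<open>f\<close>.\<close>

lemma symmetrically_indivisibleI:
  fixes M :: "'a rel_struct"
  assumes M: "is_struct M"
    and ex: "\<And>c :: 'a \<Rightarrow> bool. \<exists>b h. inj_on h (universe M) \<and> h ` universe M \<subseteq> universe M \<and>
      (\<forall>x\<in>universe M. \<forall>y\<in>universe M. (h x, h y) \<in> rel M \<longleftrightarrow> (x, y) \<in> rel M) \<and>
      (\<forall>x\<in>universe M. c (h x) = b) \<and>
      (\<forall>f. is_automorphism f M \<longrightarrow>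
        (\<exists>g. is_automorphism g M \<and> (\<forall>x\<in>universe M. g (h x) = h (f x))))"
  shows "symmetrically_indivisible M"
  unfolding symmetrically_indivisible_def
proof
  fix c :: "'a \<Rightarrow> bool"
  obtain b h where inj: "inj_on h (universe M)" and sub: "h ` universe M \<subseteq> universe M"
    and rel: "\<And>x y. x \<in> universe M \<Longrightarrow> y \<in> universe M \<Longrightarrow> (h x, h y) \<in> rel M \<longleftrightarrow> (x, y) \<in> rel M"
    and col: "\<forall>x\<in>universe M. c (h x) = b"
    and ext: "\<And>f. is_automorphism f M \<Longrightarrow>
        \<exists>g. is_automorphism g M \<and> (\<forall>x\<in>universe M. g (h x) = h (f x))"
    using ex[of c] by metis
  define M' where "M' = \<lparr>universe = h ` universe M,
    rel = rel M \<inter> (h ` universe M) \<times> (h ` universe M)\<rparr>"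
  have M': "substructure M' M"
    using sub M unfolding substructure_def is_struct_def M'_def by auto
  have h: "is_iso h M M'"
    using inj rel unfolding is_iso_def M'_def by (simp add: inj_on_imp_bij_betw)
  obtain k where k: "is_iso k M' M" and kh: "\<And>x. x \<in> universe M \<Longrightarrow> k (h x) = x"
    and hk: "\<And>y. y \<in> universe M' \<Longrightarrow> h (k y) = y"
    using is_iso_inverse[OF h] by blast
  have "symmetrically_embedded M' M"
    unfolding symmetrically_embedded_def
  proof (intro conjI allI impI M')
    fix f assume f: "is_automorphism f M'"
    have "is_automorphism (k \<circ> f \<circ> h) M"
      using is_iso_comp[OF h is_iso_comp[OF f k]] by (simp add: comp_assoc)
    then obtain g where g: "is_automorphism g M"
      and gf: "\<forall>x\<in>universe M. g (h x) = h ((k \<circ> f \<circ> h) x)"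
      using ext by blast
    have "g y = f y" if "y \<in> universe M'" for y
      using gf hk is_iso_mem[OF f that] is_iso_mem[OF k that] hk[OF that]
      by (metis comp_apply)
    with g show "\<exists>g. is_automorphism g M \<and> (\<forall>x\<in>universe M'. g x = f x)"
      by blast
  qed
  moreover have "isomorphic M' M"
    using k unfolding isomorphic_def by blast
  moreover have "\<forall>y\<in>universe M'. c y = b"
    using col unfolding M'_def by simp
  ultimately show "\<exists>M'. substructure M' M \<and> (\<exists>b. \<forall>x\<in>universe M'. c x = b) \<and>
      isomorphic M' M \<and> symmetrically_embedded M' M"
    using M' by blast
qed

section \<open>Reduction to coding sets of natural numbers\<close>

text \<open>The tags \<open>Inl\<close> and \<open>Inr\<close> keep universe and relation apart, so
  the structure itself, not just its isomorphism type, can be recovered.\<close>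

definition struct_code :: "nat rel_struct \<Rightarrow> nat set" where
  "struct_code M = to_nat ` (Inl ` universe M \<union> Inr ` rel M :: (nat + nat \<times> nat) set)"

lemma inj_struct_code: "inj struct_code"
proof (rule injI)
  fix M N assume "struct_code M = struct_code N"
  then have eq: "(Inl ` universe M \<union> Inr ` rel M :: (nat + nat \<times> nat) set)
      = Inl ` universe N \<union> Inr ` rel N"
    unfolding struct_code_def by (simp only: inj_image_eq_iff[OF inj_to_nat])
  have "universe M = universe N"
    using arg_cong[OF eq, of "\<lambda>A. Inl -` A"] by (auto simp: vimage_def image_iff)
  moreover have "rel M = rel N"
    using arg_cong[OF eq, of "\<lambda>A. Inr -` A"] by (auto simp: vimage_def image_iff)
  ultimately show "M = N" by simp
qed

text \<open>The target class of \<open>C\<close> is that of a copy of \<open>G\<close> at the code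
  of a representative of \<open>C\<close>. Isomorphic targets force equal codes, hence equal
  representatives.\<close>

lemma ex_inj_on_iso_classes:
  fixes K L :: "nat rel_struct set" and G :: "nat set \<Rightarrow> 'b rel_struct"
  assumes ex: "\<And>X. \<exists>N\<in>L. isomorphic (G X) N"
    and inj: "\<And>X Y. isomorphic (G X) (G Y) \<Longrightarrow> X = Y"
  shows "\<exists>F. inj_on F (iso_classes K) \<and> F ` iso_classes K \<subseteq> iso_classes L"
proof -
  obtain N where N: "\<And>X. N X \<in> L" "\<And>X. isomorphic (G X) (N X)"
    using ex by metis
  \<comment> \<open>Isomorphic structures may have different codes, so a class is coded through one
    chosen member.\<close>
  define rep where "rep C = (SOME M. M \<in> C)" for C :: "nat rel_struct set"
  define R where "R K = {(M, N). M \<in> K \<and> N \<in> K \<and> isomorphic M N}" for K :: "nat rel_struct set"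
  define F where "F C = R L `` {N (struct_code (rep C))}" for C
  have equiv: "equiv K (R K)" for K
    unfolding R_def by (rule equiv_isomorphic)
  have cls: "iso_classes K = K // R K" for K
    unfolding iso_classes_def R_def ..
  have "inj_on F (iso_classes K)"
  proof (rule inj_onI)
    fix C D assume C: "C \<in> iso_classes K" and D: "D \<in> iso_classes K" and "F C = F D"
    then have "(N (struct_code (rep C)), N (struct_code (rep D))) \<in> R L"
      unfolding F_def using eq_equiv_class[OF _ equiv] N(1) by blast
    then have "isomorphic (N (struct_code (rep C))) (N (struct_code (rep D)))"
      unfolding R_def by blast
    then have "isomorphic (G (struct_code (rep C))) (G (struct_code (rep D)))"
      using N(2) isomorphic_sym isomorphic_trans by metis
    then have "rep C = rep D"
      using inj inj_struct_code by (metis injD)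
    moreover have "rep C \<in> C" if "C \<in> iso_classes K" for C
      using in_quotient_imp_non_empty[OF equiv] that some_in_eq[of C]
      unfolding rep_def cls by blast
    \<comment> \<open>The common representative lies in both classes, and distinct classes are
      disjoint.\<close>
    ultimately show "C = D"
      using C D quotient_disj[OF equiv] unfolding cls by (metis disjoint_iff)
  qed
  moreover have "F ` iso_classes K \<subseteq> iso_classes L"
    unfolding F_def cls using N(1) by (auto intro: quotientI)
  ultimately show ?thesis by blast
qed

text \<open>Index \<open>k\<close> owns the two sizes \<open>2 * k + 1\<close> and
  \<open>2 * k + 2\<close>, and parity records membership in \<open>X\<close>. All sizes are
  positive.\<close>

definition block_size :: "nat set \<Rightarrow> nat \<Rightarrow> nat" where
  "block_size X k = 2 * k + 1 + of_bool (k \<in> X)"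

lemma block_size_eqD:
  assumes "block_size X k = block_size Y l"
  shows "k = l" "k \<in> X \<longleftrightarrow> k \<in> Y"
proof -
  \<comment> \<open>After subtracting 1, the membership bit is the lowest binary digit, which
    halving drops.\<close>
  have "(block_size X k - 1) div 2 = k" for X k
    unfolding block_size_def by simp
  with assms show "k = l" by metis
  with assms show "k \<in> X \<longleftrightarrow> k \<in> Y"
    unfolding block_size_def by (simp add: of_bool_eq_iff)
qed

section \<open>Disjoint unions of complete graphs\<close>

definition clique_graph :: "nat set \<Rightarrow> (nat \<times> nat) rel_struct" where
  "clique_graph X = \<lparr>universe = {(k, i). i < block_size X k},
     rel = {((k, i), (l, j)). k = l \<and> i \<noteq> j \<and> i < block_size X k \<and> j < block_size X k}\<rparr>"

lemma universe_clique_graph: "x \<in> universe (clique_graph X) \<longleftrightarrow> snd x < block_size X (fst x)"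
  unfolding clique_graph_def by (auto split: prod.splits)

lemma rel_clique_graph:
  "(x, y) \<in> rel (clique_graph X) \<longleftrightarrow> x \<in> universe (clique_graph X) \<and>
    y \<in> universe (clique_graph X) \<and> fst x = fst y \<and> x \<noteq> y"
  unfolding clique_graph_def by (auto split: prod.splits)

lemma is_struct_clique_graph: "is_struct (clique_graph X)"
proof -
  have "(0, 0) \<in> universe (clique_graph X)"
    by (simp add: universe_clique_graph block_size_def)
  then show ?thesis
    unfolding is_struct_def using rel_clique_graph by fast
qed

lemma is_graph_clique_graph: "is_graph (clique_graph X)"
  unfolding is_graph_def irrefl_def sym_def
  using is_struct_clique_graph by (auto simp: rel_clique_graph)

text \<open>A vertex together with its neighbours is a whole component, so degrees reveal component
  sizes.\<close>

lemma card_neighbours_clique_graph: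
  assumes "x \<in> universe (clique_graph X)"
  shows "Suc (card {y. (x, y) \<in> rel (clique_graph X)}) = block_size X (fst x)"
proof -
  have "insert x {y. (x, y) \<in> rel (clique_graph X)} = {fst x} \<times> {..<block_size X (fst x)}"
    using assms by (auto simp: rel_clique_graph universe_clique_graph)
  moreover from this have "finite {y. (x, y) \<in> rel (clique_graph X)}"
    by (metis finite_SigmaI finite.emptyI finite.insertI finite_insert finite_lessThan)
  moreover have "x \<notin> {y. (x, y) \<in> rel (clique_graph X)}"
    by (simp add: rel_clique_graph)
  ultimately show ?thesis
    by (metis card_insert_disjoint card_cartesian_product_singleton card_lessThan)
qed

lemma card_neighbours_is_iso:
  assumes h: "is_iso h M N" and "is_struct M" "is_struct N" and x: "x \<in> universe M"
  shows "card {y. (h x, y) \<in> rel N} = card {y. (x, y) \<in> rel M}"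
proof -
  have sub: "{y. (x, y) \<in> rel M} \<subseteq> universe M" "{y. (h x, y) \<in> rel N} \<subseteq> universe N"
    using assms unfolding is_struct_def by auto
  have "h ` {y. (x, y) \<in> rel M} = {y. (h x, y) \<in> rel N}"
  proof (intro equalityI subsetI)
    fix y assume "y \<in> h ` {y. (x, y) \<in> rel M}"
    then show "y \<in> {y. (h x, y) \<in> rel N}"
      using h x sub unfolding is_iso_def by auto
  next
    fix y assume y: "y \<in> {y. (h x, y) \<in> rel N}"
    then obtain z where "z \<in> universe M" "y = h z"
      using h sub unfolding is_iso_def bij_betw_def by blast
    with y show "y \<in> h ` {y. (x, y) \<in> rel M}"
      using h x unfolding is_iso_def by auto
  qed
  moreover have "inj_on h {y. (x, y) \<in> rel M}"
    using h sub unfolding is_iso_def bij_betw_def by (metis inj_on_subset)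
  ultimately show ?thesis
    by (metis card_image)
qed

text \<open>Isomorphisms preserve degrees, hence block sizes, and a block size determines both its
  index and the membership of that index.\<close>

lemma is_iso_clique_graph:
  assumes h: "is_iso h (clique_graph X) (clique_graph Y)" and x: "x \<in> universe (clique_graph X)"
  shows "fst (h x) = fst x" "fst x \<in> X \<longleftrightarrow> fst x \<in> Y"
proof -
  have "block_size X (fst x) = block_size Y (fst (h x))"
    using card_neighbours_clique_graph[OF x] card_neighbours_clique_graph[OF is_iso_mem[OF h x]]
      card_neighbours_is_iso[OF h is_struct_clique_graph is_struct_clique_graph x]
    by simp
  then show "fst (h x) = fst x" "fst x \<in> X \<longleftrightarrow> fst x \<in> Y"
    using block_size_eqD by metis+
qed

lemma isomorphic_clique_graphD:
  assumes "isomorphic (clique_graph X) (clique_graph Y)"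
  shows "X = Y"
proof -
  obtain h where h: "is_iso h (clique_graph X) (clique_graph Y)"
    using assms unfolding isomorphic_def by blast
  have "k \<in> X \<longleftrightarrow> k \<in> Y" for k
    using is_iso_clique_graph(2)[OF h, of "(k, 0)"]
    by (simp add: universe_clique_graph block_size_def)
  then show ?thesis by blast
qed

text \<open>The extension conjugates \<open>f\<close> by \<open>h\<close> on the image of
  \<open>h\<close> and is the identity elsewhere. Since \<open>f\<close> fixes each component
  setwise and \<open>h\<close> sends each component into a single one, the extension also fixes each
  component setwise.\<close>

lemma clique_graph_automorphism_extends:
  fixes X
  defines "U \<equiv> universe (clique_graph X)"
  assumes h: "inj_on h U" "h ` U \<subseteq> U"
    and fst_h: "\<And>x y. x \<in> U \<Longrightarrow> y \<in> U \<Longrightarrow> fst x = fst y \<Longrightarrow> fst (h x) = fst (h y)"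
    and f: "is_automorphism f (clique_graph X)"
  shows "\<exists>g. is_automorphism g (clique_graph X) \<and> (\<forall>x\<in>U. g (h x) = h (f x))"
proof -
  define k where "k = inv_into U h"
  have kh: "k (h x) = x" if "x \<in> U" for x
    using that h unfolding k_def by simp
  define g where "g y = (if y \<in> h ` U then h (f (k y)) else y)" for y
  have gh: "g (h x) = h (f x)" if "x \<in> U" for x
    using that kh unfolding g_def by simp
  have bf: "bij_betw f U U"
    using f unfolding is_iso_def U_def by blast
  have bh: "bij_betw h U (h ` U)"
    using h by (simp add: inj_on_imp_bij_betw)
  have "bij_betw (h \<circ> f \<circ> k) (h ` U) (h ` U)"
    unfolding k_def
    using bij_betw_trans[OF bij_betw_inv_into[OF bh] bij_betw_trans[OF bf bh]]
    by (simp add: comp_assoc)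
  then have "bij_betw g (h ` U) (h ` U)"
    by (rule bij_betw_cong[THEN iffD1, rotated]) (simp add: g_def)
  moreover have "bij_betw g (U - h ` U) (U - h ` U)"
    by (rule bij_betw_cong[THEN iffD1, rotated, OF bij_betw_id]) (simp add: g_def)
  ultimately have "bij_betw g (h ` U \<union> (U - h ` U)) (h ` U \<union> (U - h ` U))"
    by (rule bij_betw_combine) blast
  then have bg: "bij_betw g U U"
    using h(2) by (simp add: Un_absorb1)
  have fst_g: "fst (g y) = fst y" for y
  proof (cases "y \<in> h ` U")
    case True
    then obtain x where x: "x \<in> U" "y = h x" by blast
    have "fst (f x) = fst x" "f x \<in> U"
      using is_iso_clique_graph(1)[OF f] is_iso_mem[OF f] x unfolding U_def by auto
    then show ?thesis
      using gh[OF x(1)] fst_h[of "f x" x] x by simp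
  qed (simp add: g_def)
  \<comment> \<open>Adjacency means being distinct in the same component, so any bijection of the
    universe that keeps first coordinates preserves it.\<close>
  have "is_automorphism g (clique_graph X)"
    unfolding is_iso_def using bg fst_g bij_betw_apply[OF bg] bij_betw_imp_inj_on[OF bg]
    unfolding U_def by (auto simp: rel_clique_graph dest: inj_onD)
  with gh show ?thesis by blast
qed

text \<open>Pigeonhole: were both colours bounded from some component on, late components could not
  be as large as they are.\<close>

lemma clique_graph_unbounded_colour:
  fixes c :: "nat \<times> nat \<Rightarrow> bool"
  shows "\<exists>b. \<forall>m n. \<exists>k\<ge>m. n \<le> card {i. i < block_size X k \<and> c (k, i) = b}"
proof (rule ccontr)
  assume "\<not> ?thesis"
  then have "\<forall>b. \<exists>m n. \<forall>k\<ge>m. card {i. i < block_size X k \<and> c (k, i) = b} < n"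
    by (simp add: not_le[symmetric])
  then obtain m n
    where *: "\<And>b k. k \<ge> m b \<Longrightarrow> card {i. i < block_size X k \<and> c (k, i) = b} < n b"
    unfolding choice_iff by blast
  \<comment> \<open>Large enough to pass both thresholds \<open>m\<close> and to make the component
    larger than the sum of both bounds \<open>n\<close>.\<close>
  define k where "k = m True + m False + n True + n False"
  have "{..<block_size X k} = (\<Union>b. {i. i < block_size X k \<and> c (k, i) = b})"
    by auto
  then have "{..<block_size X k} = {i. i < block_size X k \<and> c (k, i) = True} \<union>
      {i. i < block_size X k \<and> c (k, i) = False}"
    by auto
  then have "block_size X k \<le> card {i. i < block_size X k \<and> c (k, i) = True} +
      card {i. i < block_size X k \<and> c (k, i) = False}"
    by (metis card_Un_le card_lessThan)
  also have "\<dots> < n True + n False"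
    using *[of True k] *[of False k] unfolding k_def by linarith
  finally show False
    unfolding k_def block_size_def by simp
qed

lemma symmetrically_indivisible_clique_graph: "symmetrically_indivisible (clique_graph X)"
proof (rule symmetrically_indivisibleI[OF is_struct_clique_graph])
  fix c :: "nat \<times> nat \<Rightarrow> bool"
  let ?U = "universe (clique_graph X)"
  obtain b where b: "\<And>m n. \<exists>k\<ge>m. n \<le> card {i. i < block_size X k \<and> c (k, i) = b}"
    using clique_graph_unbounded_colour by metis
  define A where "A k = {i. i < block_size X k \<and> c (k, i) = b}" for k
  \<comment> \<open>Component \<open>n\<close> will go into the vertices of colour \<open>b\<close>
    in component \<open>g n\<close>. Strict growth of \<open>g\<close> keeps different components
    apart, so non-adjacency is preserved.\<close>
  have "\<exists>g. \<forall>n. block_size X n \<le> card (A (g n)) \<and> g n < g (Suc n)"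
  proof (rule dependent_nat_choice)
    show "\<exists>k. block_size X 0 \<le> card (A k)"
      using b unfolding A_def by blast
    show "\<exists>l. block_size X (Suc n) \<le> card (A l) \<and> k < l" for k n
      using b[of "Suc k" "block_size X (Suc n)"] unfolding A_def by (auto simp: Suc_le_eq)
  qed
  then obtain g where g: "\<And>n. block_size X n \<le> card (A (g n))" "strict_mono g"
    by (auto simp: strict_mono_Suc_iff)
  have "\<exists>p. inj_on p {..<block_size X k} \<and> p ` {..<block_size X k} \<subseteq> A (g k)" for k
    using card_le_inj[of "{..<block_size X k}" "A (g k)"] g(1)[of k] by (auto simp: A_def)
  then obtain p where p: "\<And>k. inj_on (p k) {..<block_size X k}"
      "\<And>k. p k ` {..<block_size X k} \<subseteq> A (g k)"
    by metis
  define h where "h x = (g (fst x), p (fst x) (snd x))" for x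
  have g_eq: "g k = g l \<longleftrightarrow> k = l" for k l
    using g(2) by (simp add: strict_mono_eq)
  have inj: "inj_on h ?U"
    by (rule inj_onI)
      (auto simp: h_def universe_clique_graph g_eq prod_eq_iff dest: inj_onD[OF p(1)])
  have A: "p (fst x) (snd x) \<in> A (g (fst x))" if "x \<in> ?U" for x
    using p(2)[of "fst x"] that by (auto simp: universe_clique_graph)
  have sub: "h ` ?U \<subseteq> ?U"
    using A by (auto simp: h_def universe_clique_graph A_def)
  have "\<forall>x\<in>?U. \<forall>y\<in>?U. (h x, h y) \<in> rel (clique_graph X) \<longleftrightarrow> (x, y) \<in> rel (clique_graph X)"
  proof (intro ballI)
    fix x y assume xy: "x \<in> ?U" "y \<in> ?U"
    then have "h x \<in> ?U" "h y \<in> ?U" "h x = h y \<longleftrightarrow> x = y"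
      using sub inj by (auto simp: inj_on_eq_iff)
    moreover have "fst (h x) = fst (h y) \<longleftrightarrow> fst x = fst y"
      by (simp add: h_def g_eq)
    ultimately show "(h x, h y) \<in> rel (clique_graph X) \<longleftrightarrow> (x, y) \<in> rel (clique_graph X)"
      using xy by (simp add: rel_clique_graph)
  qed
  moreover have "\<forall>x\<in>?U. c (h x) = b"
    using A by (auto simp: h_def A_def)
  moreover have "\<exists>g. is_automorphism g (clique_graph X) \<and> (\<forall>x\<in>?U. g (h x) = h (f x))"
    if "is_automorphism f (clique_graph X)" for f
    \<comment> \<open>The first coordinate of \<open>h x\<close> depends only on that of
      \<open>x\<close>.\<close>
    by (rule clique_graph_automorphism_extends[OF inj sub _ that]) (simp add: h_def)
  ultimately show "\<exists>b h. inj_on h ?U \<and> h ` ?U \<subseteq> ?U \<and>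
      (\<forall>x\<in>?U. \<forall>y\<in>?U. (h x, h y) \<in> rel (clique_graph X) \<longleftrightarrow> (x, y) \<in> rel (clique_graph X)) \<and>
      (\<forall>x\<in>?U. c (h x) = b) \<and>
      (\<forall>f. is_automorphism f (clique_graph X) \<longrightarrow>
        (\<exists>g. is_automorphism g (clique_graph X) \<and> (\<forall>x\<in>?U. g (h x) = h (f x))))"
    using inj sub by (intro exI[of _ b] exI[of _ h]) blast
qed

section \<open>Embedding countable linear orders into dense ones\<close>

text \<open>By Cantor's theorem, the countable sets of this kind are exactly the copies of the
  rationals.\<close>

definition dense_unbounded :: "'a::linorder set \<Rightarrow> bool" where
  "dense_unbounded D \<longleftrightarrow> D \<noteq> {} \<and> (\<forall>x\<in>D. (\<exists>y\<in>D. y < x) \<and> (\<exists>y\<in>D. x < y)) \<and>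
     (\<forall>x\<in>D. \<forall>y\<in>D. x < y \<longrightarrow> (\<exists>z\<in>D. x < z \<and> z < y))"

text \<open>The one-point extension step: only the maximum of \<open>A\<close> and the minimum of
  \<open>B\<close> matter. Density serves when both exist, absence of endpoints when one does, and
  nonemptiness when neither does.\<close>

lemma dense_unbounded_separate:
  assumes D: "dense_unbounded D" and fin: "finite A" "finite B" and sub: "A \<subseteq> D" "B \<subseteq> D"
    and less: "\<And>a b. a \<in> A \<Longrightarrow> b \<in> B \<Longrightarrow> a < b"
  shows "\<exists>d\<in>D. (\<forall>a\<in>A. a < d) \<and> (\<forall>b\<in>B. d < b)"
proof -
  have A: "Max A \<in> D" "\<And>d. Max A < d \<Longrightarrow> \<forall>a\<in>A. a < d" if "A \<noteq> {}"
    using that fin(1) sub(1) subsetD[OF sub(1) Max_in] by auto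
  have B: "Min B \<in> D" "\<And>d. d < Min B \<Longrightarrow> \<forall>b\<in>B. d < b" if "B \<noteq> {}"
    using that fin(2) sub(2) subsetD[OF sub(2) Min_in] by auto
  have AB: "Max A < Min B" if "A \<noteq> {}" "B \<noteq> {}"
    using that fin less by simp
  show ?thesis
  proof (cases "A = {}"; cases "B = {}")
    assume "A = {}" "B = {}"
    then show ?thesis using D unfolding dense_unbounded_def by auto
  next
    assume "A = {}" "B \<noteq> {}"
    then show ?thesis using D B unfolding dense_unbounded_def by (metis empty_iff)
  next
    assume "A \<noteq> {}" "B = {}"
    then show ?thesis using D A unfolding dense_unbounded_def by (metis empty_iff)
  next
    assume "A \<noteq> {}" "B \<noteq> {}"
    then show ?thesis using D A B AB unfolding dense_unbounded_def by metis
  qed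
qed

text \<open>The forth half of Cantor's back-and-forth argument: images are chosen along the
  naturals, each in the cut left by the finitely many earlier images.\<close>

lemma nat_linorder_embeds:
  fixes r :: "(nat \<times> nat) set" and D :: "'a::linorder set"
  assumes r: "strict_linear_order_on U r" and D: "dense_unbounded D"
  shows "\<exists>f. (\<forall>m. f m \<in> D) \<and> (\<forall>m\<in>U. \<forall>n\<in>U. (m, n) \<in> r \<longrightarrow> f m < f n)"
proof -
  \<comment> \<open>\<open>d\<close> is admissible as the value at \<open>n\<close>, given the
    values of \<open>f\<close> below \<open>n\<close>. Outside \<open>U\<close> any element of
    \<open>D\<close> will do, which makes \<open>f\<close> total.\<close>
  define P where "P f n d \<longleftrightarrow> d \<in> D \<and> (n \<in> U \<longrightarrow>
    (\<forall>m\<in>U. m < n \<longrightarrow> ((m, n) \<in> r \<longrightarrow> f m < d) \<and> ((n, m) \<in> r \<longrightarrow> d < f m)))" for f :: "nat \<Rightarrow> 'a" and n d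
  have trans: "trans r" and total: "total_on U r" and irrefl: "irrefl r"
    using r unfolding strict_linear_order_on_def by auto
  \<comment> \<open>Stated below a bound \<open>N\<close> because during the recursion only earlier
    choices are known to be admissible.\<close>
  have mono: "f m < f n"
    if P: "\<And>k. k < N \<Longrightarrow> P f k (f k)" and "m \<in> U" "n \<in> U" "m < N" "n < N" "(m, n) \<in> r" for f m n N
  proof (cases m n rule: linorder_cases)
    case less
    then show ?thesis using P[of n] that unfolding P_def by blast
  next
    case greater
    then show ?thesis using P[of m] that unfolding P_def by blast
  next
    case equal
    then show ?thesis using that irrefl unfolding irrefl_def by blast
  qed
  have "\<exists>f. \<forall>n. P f n (f n)"
  proof (rule dependent_wf_choice[OF wf_less_than])
    show "P f n d = P g n d" if "\<And>m. (m, n) \<in> less_than \<Longrightarrow> f m = g m" for f g n d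
      using that unfolding P_def by auto
    show "\<exists>d. P f n d" if "\<And>m. (m, n) \<in> less_than \<Longrightarrow> P f m (f m)" for f n
    proof (cases "n \<in> U")
      case True
      have Pf: "\<And>m. m < n \<Longrightarrow> P f m (f m)"
        using that by simp
      \<comment> \<open>\<open>A\<close> and \<open>B\<close> are the earlier images that must lie
        below and above the new one; transitivity through \<open>n\<close> puts \<open>A\<close>
        below \<open>B\<close>.\<close>
      define A where "A = f ` {m \<in> U. m < n \<and> (m, n) \<in> r}"
      define B where "B = f ` {m \<in> U. m < n \<and> (n, m) \<in> r}"
      have "\<exists>d\<in>D. (\<forall>a\<in>A. a < d) \<and> (\<forall>b\<in>B. d < b)"
      proof (rule dense_unbounded_separate[OF D])
        show "A \<subseteq> D" "B \<subseteq> D"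
          using Pf unfolding A_def B_def P_def by auto
        show "a < b" if "a \<in> A" "b \<in> B" for a b
          using that mono[OF Pf] trans unfolding A_def B_def by (auto dest: transD)
      qed (simp_all add: A_def B_def)
      then obtain d where "d \<in> D" "\<And>a. a \<in> A \<Longrightarrow> a < d" "\<And>b. b \<in> B \<Longrightarrow> d < b"
        by blast
      then have "P f n d"
        unfolding P_def A_def B_def by auto
      then show ?thesis ..
    next
      case False
      then show ?thesis
        using D unfolding P_def dense_unbounded_def by blast
    qed
  qed
  then obtain f where f: "\<And>n. P f n (f n)" by blast
  then have "f m < f n" if "m \<in> U" "n \<in> U" "(m, n) \<in> r" for m n
    using mono[of "Suc (max m n)"] that by force
  then show ?thesis
    using f unfolding P_def by blast
qed

text \<open>Passing to a copy on the naturals makes the recursion available; totality turns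
  preservation of the order into an equivalence.\<close>

lemma countable_linorder_embeds:
  fixes M :: "'b rel_struct" and D :: "'a::linorder set"
  assumes M: "is_linorder M" "countable (universe M)" and D: "dense_unbounded D"
  shows "\<exists>f. \<forall>x\<in>universe M. f x \<in> D \<and> (\<forall>y\<in>universe M. f x < f y \<longleftrightarrow> (x, y) \<in> rel M)"
proof -
  have "is_struct M"
    using M unfolding is_linorder_def by blast
  then obtain N :: "nat rel_struct" and h where N: "is_linorder N" and h: "is_iso h M N"
    using countable_struct_has_nat_copy M unfolding isomorphic_def by metis
  obtain e where e: "\<And>m. e m \<in> D"
    "\<And>m n. m \<in> universe N \<Longrightarrow> n \<in> universe N \<Longrightarrow> (m, n) \<in> rel N \<Longrightarrow> e m < e n"
    using nat_linorder_embeds D N unfolding is_linorder_def by metis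
  have less: "e (h x) < e (h y)" if "x \<in> universe M" "y \<in> universe M" "(x, y) \<in> rel M" for x y
    using that e(2) h is_iso_mem[OF h] unfolding is_iso_def by blast
  have "e (h x) < e (h y) \<longleftrightarrow> (x, y) \<in> rel M" if "x \<in> universe M" "y \<in> universe M" for x y
    using less that M unfolding is_linorder_def strict_linear_order_on_def total_on_def
    by (metis less_asym less_irrefl)
  then show ?thesis
    using e(1) by (intro exI[of _ "e \<circ> h"]) simp
qed

text \<open>Either some open interval is entirely \<open>True\<close>, and it serves as
  \<open>D\<close>, or every open interval has a \<open>False\<close> point, and the whole
  \<open>False\<close> class serves.\<close>

lemma rat_monochromatic_dense_unbounded:
  fixes c :: "rat \<Rightarrow> bool"
  shows "\<exists>b D. dense_unbounded D \<and> (\<forall>q\<in>D. c q = b)"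
proof (cases "\<exists>p q. p < q \<and> (\<forall>x. p < x \<and> x < q \<longrightarrow> c x)")
  case True
  then obtain p q where pq: "p < q" "\<And>x. p < x \<Longrightarrow> x < q \<Longrightarrow> c x" by blast
  have "dense_unbounded {p<..<q}"
    unfolding dense_unbounded_def
  proof (intro conjI ballI impI)
    show "{p<..<q} \<noteq> {}" using pq(1) by simp
    fix x assume x: "x \<in> {p<..<q}"
    show "\<exists>y\<in>{p<..<q}. y < x" using x dense[of p x] by auto
    show "\<exists>y\<in>{p<..<q}. x < y" using x dense[of x q] by auto
    fix y assume "y \<in> {p<..<q}" "x < y"
    then show "\<exists>z\<in>{p<..<q}. x < z \<and> z < y" using x dense[of x y] by auto
  qed
  then show ?thesis using pq(2) by (metis greaterThanLessThan_iff)
next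
  case False
  then have ex: "\<exists>x. p < x \<and> x < q \<and> \<not> c x" if "p < q" for p q
    using that by blast
  have "dense_unbounded {x. \<not> c x}"
    unfolding dense_unbounded_def
    using ex ex[of 0 1] lt_ex gt_ex by (auto; metis)
  then show ?thesis by blast
qed

section \<open>Rigid shuffles of finite chains\<close>

definition rat_index :: "rat \<Rightarrow> nat" where
  "rat_index = to_nat_on UNIV"

lemma bij_rat_index: "bij rat_index"
  unfolding rat_index_def
  by (rule to_nat_on_infinite) (simp_all add: infinite_UNIV_char_0)

definition shuffle_order :: "nat set \<Rightarrow> (rat \<times> nat) rel_struct" where
  "shuffle_order X = \<lparr>universe = {(q, i). i < block_size X (rat_index q)},
     rel = {((p, i), (q, j)). i < block_size X (rat_index p) \<and> j < block_size X (rat_index q) \<and>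
       (p < q \<or> p = q \<and> i < j)}\<rparr>"

lemma universe_shuffle_order:
  "x \<in> universe (shuffle_order X) \<longleftrightarrow> snd x < block_size X (rat_index (fst x))"
  unfolding shuffle_order_def by (auto split: prod.splits)

lemma rel_shuffle_order:
  "(x, y) \<in> rel (shuffle_order X) \<longleftrightarrow> x \<in> universe (shuffle_order X) \<and>
    y \<in> universe (shuffle_order X) \<and> (fst x < fst y \<or> fst x = fst y \<and> snd x < snd y)"
  unfolding shuffle_order_def by (auto split: prod.splits)

lemma first_mem_shuffle_order: "(q, 0) \<in> universe (shuffle_order X)"
  by (simp add: universe_shuffle_order block_size_def)

lemma is_linorder_shuffle_order: "is_linorder (shuffle_order X)"
  unfolding is_linorder_def strict_linear_order_on_def
proof (intro conjI)
  show "is_struct (shuffle_order X)"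
    unfolding is_struct_def using first_mem_shuffle_order rel_shuffle_order by fast
  show "trans (rel (shuffle_order X))"
    by (rule transI) (auto simp: rel_shuffle_order)
  show "irrefl (rel (shuffle_order X))"
    by (auto simp: irrefl_def rel_shuffle_order)
  show "total_on (universe (shuffle_order X)) (rel (shuffle_order X))"
    by (auto simp: total_on_def rel_shuffle_order)
qed

text \<open>For a linear order, the class of \<open>x\<close> in its finite condensation.\<close>

definition finite_block :: "'a rel_struct \<Rightarrow> 'a \<Rightarrow> 'a set" where
  "finite_block M x = {y \<in> universe M.
     finite {z \<in> universe M. ((x, z) \<in> rel M \<and> (z, y) \<in> rel M) \<or> ((y, z) \<in> rel M \<and> (z, x) \<in> rel M)}}"

text \<open>The block is defined from the order alone, and an isomorphism carries intervals onto
  intervals of the same cardinality.\<close>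

lemma finite_block_is_iso:
  assumes h: "is_iso h M N" and x: "x \<in> universe M"
  shows "finite_block N (h x) = h ` finite_block M x"
proof -
  have bij: "bij_betw h (universe M) (universe N)"
    and rel: "\<And>y z. y \<in> universe M \<Longrightarrow> z \<in> universe M \<Longrightarrow> (h y, h z) \<in> rel N \<longleftrightarrow> (y, z) \<in> rel M"
    using h unfolding is_iso_def by auto
  have uN: "universe N = h ` universe M"
    using bij unfolding bij_betw_def by simp
  \<comment> \<open>The points strictly between \<open>x\<close> and \<open>y\<close>, whichever of
    the two comes first.\<close>
  define I where "I y = {z \<in> universe M. ((x, z) \<in> rel M \<and> (z, y) \<in> rel M) \<or> ((y, z) \<in> rel M \<and> (z, x) \<in> rel M)}" for y
  have *: "{z \<in> universe N. ((h x, z) \<in> rel N \<and> (z, h y) \<in> rel N) \<or> ((h y, z) \<in> rel N \<and> (z, h x) \<in> rel N)} = h ` I y"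
    if "y \<in> universe M" for y
    using that x rel unfolding uN I_def by auto
  have "finite (h ` I y) \<longleftrightarrow> finite (I y)" for y
    by (rule finite_image_iff, rule inj_on_subset[OF bij_betw_imp_inj_on[OF bij]])
      (auto simp: I_def)
  with * show ?thesis
    unfolding finite_block_def I_def[symmetric] uN by auto
qed

lemma card_is_iso_predecessors:
  assumes h: "is_iso h M N" and x: "x \<in> universe M" and A: "A \<subseteq> universe M"
  shows "card {y \<in> h ` A. (y, h x) \<in> rel N} = card {y \<in> A. (y, x) \<in> rel M}"
proof -
  have "{y \<in> h ` A. (y, h x) \<in> rel N} = h ` {y \<in> A. (y, x) \<in> rel M}"
    using h x A unfolding is_iso_def by auto
  moreover have "inj_on h {y \<in> A. (y, x) \<in> rel M}"
    using h A unfolding is_iso_def bij_betw_def by (auto intro: inj_on_subset)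
  ultimately show ?thesis by (simp add: card_image)
qed

text \<open>Between points over one rational there is only part of a finite chain; between points
  over two rationals lie the chains of infinitely many others.\<close>

lemma finite_block_shuffle_order:
  assumes x: "x \<in> universe (shuffle_order X)"
  shows "finite_block (shuffle_order X) x = {fst x} \<times> {..<block_size X (rat_index (fst x))}"
proof -
  let ?I = "\<lambda>y. {z \<in> universe (shuffle_order X).
    ((x, z) \<in> rel (shuffle_order X) \<and> (z, y) \<in> rel (shuffle_order X)) \<or>
    ((y, z) \<in> rel (shuffle_order X) \<and> (z, x) \<in> rel (shuffle_order X))}"
  have "finite (?I y) \<longleftrightarrow> fst y = fst x" if y: "y \<in> universe (shuffle_order X)" for y
  proof
    assume "fst y = fst x"
    then have "?I y \<subseteq> {fst x} \<times> {..<block_size X (rat_index (fst x))}"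
      by (auto simp: rel_shuffle_order universe_shuffle_order)
    then show "finite (?I y)"
      by (rule finite_subset) simp
  next
    assume fin: "finite (?I y)"
    show "fst y = fst x"
    proof (rule ccontr)
      define p where "p = min (fst x) (fst y)"
      define q where "q = max (fst x) (fst y)"
      assume "fst y \<noteq> fst x"
      then have "p < q" unfolding p_def q_def by (auto simp: min_def max_def)
      \<comment> \<open>The first points of the intermediate chains already form an infinite
        set.\<close>
      have "(\<lambda>r. (r, 0)) ` {p<..<q} \<subseteq> ?I y"
        using x y first_mem_shuffle_order
        by (auto simp: p_def q_def rel_shuffle_order min_def max_def split: if_splits)
      then have "finite ((\<lambda>r. (r, 0::nat)) ` {p<..<q})"
        using fin finite_subset by blast
      then have "finite {p<..<q}"
        by (rule finite_imageD) (simp add: inj_on_def)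
      with \<open>p < q\<close> show False
        by (simp add: infinite_Ioo)
    qed
  qed
  then show ?thesis
    unfolding finite_block_def using x
    by (auto simp: universe_shuffle_order)
qed

text \<open>The size of its block determines the first coordinate of a point, and the number of
  predecessors inside the block is the second. With \<open>Y\<close> equal to \<open>X\<close> this
  is rigidity.\<close>

lemma is_iso_shuffle_order:
  assumes h: "is_iso h (shuffle_order X) (shuffle_order Y)"
    and x: "x \<in> universe (shuffle_order X)"
  shows "h x = x" "rat_index (fst x) \<in> X \<longleftrightarrow> rat_index (fst x) \<in> Y"
proof -
  note hx = is_iso_mem[OF h x]
  have pos: "card {y \<in> finite_block (shuffle_order X) x. (y, x) \<in> rel (shuffle_order X)} = snd x"
    if "x \<in> universe (shuffle_order X)" for X x
  proof -
    have "{y \<in> finite_block (shuffle_order X) x. (y, x) \<in> rel (shuffle_order X)}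
        = {fst x} \<times> {..<snd x}"
      unfolding finite_block_shuffle_order[OF that] using that
      by (auto simp: rel_shuffle_order universe_shuffle_order)
    then show ?thesis by simp
  qed
  have sub: "finite_block (shuffle_order X) x \<subseteq> universe (shuffle_order X)"
    unfolding finite_block_def by blast
  have "inj_on h (finite_block (shuffle_order X) x)"
    using h sub unfolding is_iso_def bij_betw_def by (auto intro: inj_on_subset)
  then have "card (finite_block (shuffle_order Y) (h x)) = card (finite_block (shuffle_order X) x)"
    unfolding finite_block_is_iso[OF h x] by (rule card_image)
  then have size: "block_size X (rat_index (fst x)) = block_size Y (rat_index (fst (h x)))"
    unfolding finite_block_shuffle_order[OF x] finite_block_shuffle_order[OF hx] by simp
  then have "fst (h x) = fst x"
    using block_size_eqD(1) bij_is_inj[OF bij_rat_index] by (metis injD)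
  moreover have "snd (h x) = snd x"
    using pos[OF hx] pos[OF x] card_is_iso_predecessors[OF h x sub]
    unfolding finite_block_is_iso[OF h x] by simp
  ultimately show "h x = x" by (simp add: prod_eq_iff)
  show "rat_index (fst x) \<in> X \<longleftrightarrow> rat_index (fst x) \<in> Y"
    using block_size_eqD(2)[OF size] .
qed

lemma isomorphic_shuffle_orderD:
  assumes "isomorphic (shuffle_order X) (shuffle_order Y)"
  shows "X = Y"
proof -
  obtain h where h: "is_iso h (shuffle_order X) (shuffle_order Y)"
    using assms unfolding isomorphic_def by blast
  have "rat_index q \<in> X \<longleftrightarrow> rat_index q \<in> Y" for q
    using is_iso_shuffle_order(2)[OF h first_mem_shuffle_order] by simp
  then show ?thesis
    using bij_is_surj[OF bij_rat_index] by (metis subsetI subset_antisym surjD)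
qed

lemma symmetrically_indivisible_shuffle_order: "symmetrically_indivisible (shuffle_order X)"
proof (rule symmetrically_indivisibleI)
  show "is_struct (shuffle_order X)"
    using is_linorder_shuffle_order unfolding is_linorder_def by blast
next
  fix c :: "rat \<times> nat \<Rightarrow> bool"
  let ?M = "shuffle_order X"
  let ?U = "universe ?M"
  \<comment> \<open>Only the first points of the chains are used: they are ordered like the
    rationals, so the colouring restricts to one of the rationals.\<close>
  obtain b D where D: "dense_unbounded D" and b: "\<And>q. q \<in> D \<Longrightarrow> c (q, 0) = b"
    using rat_monochromatic_dense_unbounded[of "\<lambda>q. c (q, 0)"] by blast
  obtain e where eD: "\<And>x. x \<in> ?U \<Longrightarrow> e x \<in> D"
    and e: "\<And>x y. x \<in> ?U \<Longrightarrow> y \<in> ?U \<Longrightarrow> e x < e y \<longleftrightarrow> (x, y) \<in> rel ?M"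
    using countable_linorder_embeds[OF is_linorder_shuffle_order _ D, of X] by auto
  define h :: "rat \<times> nat \<Rightarrow> rat \<times> nat" where "h x = (e x, 0)" for x
  have "inj_on e ?U"
    using e is_linorder_shuffle_order[of X]
    unfolding is_linorder_def strict_linear_order_on_def total_on_def
    by (metis inj_onI less_irrefl)
  then have inj: "inj_on h ?U"
    unfolding h_def inj_on_def by simp
  have sub: "h ` ?U \<subseteq> ?U"
    unfolding h_def using first_mem_shuffle_order by blast
  have "\<forall>x\<in>?U. \<forall>y\<in>?U. (h x, h y) \<in> rel ?M \<longleftrightarrow> (x, y) \<in> rel ?M"
    using e first_mem_shuffle_order unfolding rel_shuffle_order[of "h _"] by (simp add: h_def)
  moreover have "\<forall>x\<in>?U. c (h x) = b"
    using b eD unfolding h_def by simp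
  moreover have "\<exists>g. is_automorphism g ?M \<and> (\<forall>x\<in>?U. g (h x) = h (f x))"
    if "is_automorphism f ?M" for f
  \<comment> \<open>By rigidity \<open>f\<close> is the identity on the universe, so it serves as
    its own extension.\<close>
  proof (intro exI[of _ f] conjI ballI that)
    fix x assume x: "x \<in> ?U"
    with sub have "h x \<in> ?U" by blast
    with x show "f (h x) = h (f x)"
      using is_iso_shuffle_order(1)[OF that] by simp
  qed
  ultimately show "\<exists>b h. inj_on h ?U \<and> h ` ?U \<subseteq> ?U \<and>
      (\<forall>x\<in>?U. \<forall>y\<in>?U. (h x, h y) \<in> rel ?M \<longleftrightarrow> (x, y) \<in> rel ?M) \<and>
      (\<forall>x\<in>?U. c (h x) = b) \<and>
      (\<forall>f. is_automorphism f ?M \<longrightarrow>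
        (\<exists>g. is_automorphism g ?M \<and> (\<forall>x\<in>?U. g (h x) = h (f x))))"
    using inj sub by (intro exI[of _ b] exI[of _ h]) blast
qed

section \<open>The two injections on isomorphism classes, obtained from the codings\<close>

theorem corollary2p15:
  shows "(\<exists>F :: nat rel_struct set \<Rightarrow> nat rel_struct set.
            inj_on F (iso_classes countable_graphs) \<and>
            F ` iso_classes countable_graphs \<subseteq>
              iso_classes {M \<in> countable_graphs. symmetrically_indivisible M})
       \<and> (\<exists>F :: nat rel_struct set \<Rightarrow> nat rel_struct set.
            inj_on F (iso_classes countable_linorders) \<and>
            F ` iso_classes countable_linorders \<subseteq>
              iso_classes {M \<in> countable_linorders. symmetrically_indivisible M})"
proof
  \<comment> \<open>The coding graph is countable, and its copy on the naturals inherits symmetric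
    indivisibility.\<close>
  have "\<exists>N :: nat rel_struct\<in>{M \<in> countable_graphs. symmetrically_indivisible M}.
      isomorphic (clique_graph X) N" for X
    using countable_struct_has_nat_copy[OF is_struct_clique_graph[of X]]
      is_graph_clique_graph[of X] symmetrically_indivisible_clique_graph[of X]
      symmetrically_indivisible_isomorphic
    unfolding countable_graphs_def by fastforce
  then show "\<exists>F :: nat rel_struct set \<Rightarrow> nat rel_struct set.
            inj_on F (iso_classes countable_graphs) \<and>
            F ` iso_classes countable_graphs \<subseteq>
              iso_classes {M \<in> countable_graphs. symmetrically_indivisible M}"
    using isomorphic_clique_graphD by (rule ex_inj_on_iso_classes)
next
  have "is_struct (shuffle_order X)" for X
    using is_linorder_shuffle_order unfolding is_linorder_def by blast
  then have "\<exists>N :: nat rel_struct\<in>{M \<in> countable_linorders. symmetrically_indivisible M}.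
      isomorphic (shuffle_order X) N" for X
    using countable_struct_has_nat_copy[of "shuffle_order X"]
      is_linorder_shuffle_order[of X] symmetrically_indivisible_shuffle_order[of X]
      symmetrically_indivisible_isomorphic
    unfolding countable_linorders_def by fastforce
  then show "\<exists>F :: nat rel_struct set \<Rightarrow> nat rel_struct set.
            inj_on F (iso_classes countable_linorders) \<and>
            F ` iso_classes countable_linorders \<subseteq>
              iso_classes {M \<in> countable_linorders. symmetrically_indivisible M}"
    using isomorphic_shuffle_orderD by (rule ex_inj_on_iso_classes)
qed

end
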